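(* Let $G$ be a finite nilpotent group and let $H$ be a subgroup of $G$ such that $|\mathcal{I}tp(G,H)|=1$, i.e. all normalized right transversals of $H$ in $G$, with their induced right loop structures, are pairwise isotopic. Then $H$ is normal in $G$.
   Context: A normalized right transversal (NRT) of a subgroup $H$ in a group $G$ is a subset $S\subseteq G$ with $1\in S$ containing exactly one element of each right coset $Hg$, $g\in G$. It carries the induced binary operation $\circ$ determined by $\{x\circ y\}=Hxy\cap S$ for $x,y\in S$; with it $S$ is a right loop with identity $1$, i.e. a set with a binary operation having a two-sided identity such that for all $a,b$ the equation $X\circ a=b$ has a unique solution $X$. Two sets with binary operation $(S,\circ)$ and $(S',\circ')$ are isotopic if there are bijections $\alpha,\beta,\gamma:S\to S'$ with $\alpha(x)\circ'\beta(y)=\gamma(x\circ y)$ for all $x,y\in S$. $\mathcal{T}(G,H)$ denotes the set of all NRTs of $H$ in $G$, and $\mathcal{I}tp(G,H)$ denotes the set of isotopy classes of elements of $\mathcal{T}(G,H)$, where two NRTs are called isotopic if their induced right loops are isotopic. *)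

theory Defs
  imports "HOL-Algebra.Coset" "HOL-Algebra.Generated_Groups"
begin

section \<open>Nilpotent groups\<close>

definition commutator_subgroup ::
    "('a, 'b) monoid_scheme \<Rightarrow> 'a set \<Rightarrow> 'a set \<Rightarrow> 'a set" where
  "commutator_subgroup G H K =
     generate G (\<Union>h\<in>H. \<Union>k\<in>K. {h \<otimes>\<^bsub>G\<^esub> k \<otimes>\<^bsub>G\<^esub> inv\<^bsub>G\<^esub> h \<otimes>\<^bsub>G\<^esub> inv\<^bsub>G\<^esub> k})"

primrec lower_central :: "('a, 'b) monoid_scheme \<Rightarrow> nat \<Rightarrow> 'a set" where
  "lower_central G 0 = carrier G"
| "lower_central G (Suc n) = commutator_subgroup G (lower_central G n) (carrier G)"

locale nilpotent_group = group +
  assumes nilpotent: "\<exists>n. lower_central G n = {\<one>}"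

section \<open>Normalized right transversals and their induced right loops\<close>

definition NRTs :: "('a, 'b) monoid_scheme \<Rightarrow> 'a set \<Rightarrow> 'a set set" where
  "NRTs G H = {S. S \<subseteq> carrier G \<and> \<one>\<^bsub>G\<^esub> \<in> S \<and> (\<forall>C \<in> rcosets\<^bsub>G\<^esub> H. \<exists>!x. x \<in> C \<inter> S)}"

text \<open>The intersection below is a singleton whenever \<^term>\<open>S\<close> is a normalized right
  transversal and \<^term>\<open>x\<close>, \<^term>\<open>y\<close> lie in \<^term>\<open>S\<close>; see \<open>nrt_op_eq\<close>.\<close>

definition nrt_op :: "('a, 'b) monoid_scheme \<Rightarrow> 'a set \<Rightarrow> 'a set \<Rightarrow> 'a \<Rightarrow> 'a \<Rightarrow> 'a" where
  "nrt_op G H S x y = the_elem ((H #>\<^bsub>G\<^esub> (x \<otimes>\<^bsub>G\<^esub> y)) \<inter> S)"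

lemma nrt_op_eq:
  assumes "group G" "S \<in> NRTs G H" "x \<in> S" "y \<in> S"
  shows "{nrt_op G H S x y} = (H #>\<^bsub>G\<^esub> (x \<otimes>\<^bsub>G\<^esub> y)) \<inter> S"
proof -
  interpret group G by fact
  have "x \<otimes>\<^bsub>G\<^esub> y \<in> carrier G"
    using assms by (auto simp: NRTs_def)
  then have "H #>\<^bsub>G\<^esub> (x \<otimes>\<^bsub>G\<^esub> y) \<in> rcosets\<^bsub>G\<^esub> H"
    by (auto simp: RCOSETS_def)
  then have "\<exists>!z. z \<in> (H #>\<^bsub>G\<^esub> (x \<otimes>\<^bsub>G\<^esub> y)) \<inter> S"
    using assms(2) by (simp add: NRTs_def)
  then obtain z where "(H #>\<^bsub>G\<^esub> (x \<otimes>\<^bsub>G\<^esub> y)) \<inter> S = {z}"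
    by blast
  then show ?thesis
    by (simp add: nrt_op_def)
qed

lemma nrt_op_closed:
  assumes "group G" "S \<in> NRTs G H" "x \<in> S" "y \<in> S"
  shows "nrt_op G H S x y \<in> S"
  using nrt_op_eq[OF assms] by blast

section \<open>Isotopy\<close>

definition isotopic :: "'a set \<Rightarrow> ('a \<Rightarrow> 'a \<Rightarrow> 'a) \<Rightarrow> 'b set \<Rightarrow> ('b \<Rightarrow> 'b \<Rightarrow> 'b) \<Rightarrow> bool" where
  "isotopic S f S' f' \<longleftrightarrow>
     (\<exists>\<alpha> \<beta> \<gamma>. bij_betw \<alpha> S S' \<and> bij_betw \<beta> S S' \<and> bij_betw \<gamma> S S' \<and>
        (\<forall>x\<in>S. \<forall>y\<in>S. f' (\<alpha> x) (\<beta> y) = \<gamma> (f x y)))"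

definition isotopy_rel :: "('a, 'b) monoid_scheme \<Rightarrow> 'a set \<Rightarrow> ('a set \<times> 'a set) set" where
  "isotopy_rel G H =
     {(S, S'). S \<in> NRTs G H \<and> S' \<in> NRTs G H \<and>
        isotopic S (nrt_op G H S) S' (nrt_op G H S')}"

definition Itp :: "('a, 'b) monoid_scheme \<Rightarrow> 'a set \<Rightarrow> 'a set set set" where
  "Itp G H = NRTs G H // isotopy_rel G H"

lemma isotopic_refl: "isotopic S f S f"
  unfolding isotopic_def by (intro exI[of _ id]) auto

lemma isotopic_sym:
  assumes "isotopic S f S' f'" and closed: "\<And>x y. x \<in> S \<Longrightarrow> y \<in> S \<Longrightarrow> f x y \<in> S"
  shows "isotopic S' f' S f"
proof -
  obtain \<alpha> \<beta> \<gamma> where b: "bij_betw \<alpha> S S'" "bij_betw \<beta> S S'" "bij_betw \<gamma> S S'"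
    and e: "\<And>x y. x \<in> S \<Longrightarrow> y \<in> S \<Longrightarrow> f' (\<alpha> x) (\<beta> y) = \<gamma> (f x y)"
    using assms(1) unfolding isotopic_def by blast
  let ?a = "inv_into S \<alpha>" and ?b = "inv_into S \<beta>" and ?c = "inv_into S \<gamma>"
  have "f (?a x) (?b y) = ?c (f' x y)" if "x \<in> S'" "y \<in> S'" for x y
  proof -
    have m: "?a x \<in> S" "?b y \<in> S"
      using b that by (auto simp: bij_betw_def inv_into_into)
    then have "f' x y = \<gamma> (f (?a x) (?b y))"
      using e[OF m] b that by (simp add: bij_betw_inv_into_right)
    then show ?thesis
      using b(3) closed[OF m] by (simp add: bij_betw_inv_into_left)
  qed
  then show ?thesis
    unfolding isotopic_def
    using b[THEN bij_betw_inv_into] by (intro exI[of _ ?a] exI[of _ ?b] exI[of _ ?c]) simp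
qed

lemma isotopic_trans:
  assumes "isotopic S f S' f'" "isotopic S' f' S'' f''"
  shows "isotopic S f S'' f''"
proof -
  obtain \<alpha> \<beta> \<gamma> where b: "bij_betw \<alpha> S S'" "bij_betw \<beta> S S'" "bij_betw \<gamma> S S'"
    and e: "\<forall>x\<in>S. \<forall>y\<in>S. f' (\<alpha> x) (\<beta> y) = \<gamma> (f x y)"
    using assms(1) unfolding isotopic_def by blast
  obtain \<alpha>' \<beta>' \<gamma>' where b': "bij_betw \<alpha>' S' S''" "bij_betw \<beta>' S' S''" "bij_betw \<gamma>' S' S''"
    and e': "\<forall>x\<in>S'. \<forall>y\<in>S'. f'' (\<alpha>' x) (\<beta>' y) = \<gamma>' (f' x y)"
    using assms(2) unfolding isotopic_def by blast
  have "\<forall>x\<in>S. \<forall>y\<in>S. f'' ((\<alpha>' \<circ> \<alpha>) x) ((\<beta>' \<circ> \<beta>) y) = (\<gamma>' \<circ> \<gamma>) (f x y)"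
    using e e' b by (simp add: bij_betw_apply)
  then show ?thesis
    unfolding isotopic_def
    using bij_betw_trans[OF b(1) b'(1)] bij_betw_trans[OF b(2) b'(2)] bij_betw_trans[OF b(3) b'(3)]
    by (intro exI conjI)
qed

lemma equiv_isotopy_rel:
  assumes "group G"
  shows "equiv (NRTs G H) (isotopy_rel G H)"
proof (rule equivI)
  show "isotopy_rel G H \<subseteq> NRTs G H \<times> NRTs G H"
    by (auto simp: isotopy_rel_def)
  show "refl_on (NRTs G H) (isotopy_rel G H)"
    by (auto simp: refl_on_def isotopy_rel_def isotopic_refl)
  show "sym (isotopy_rel G H)"
    unfolding isotopy_rel_def
    by (rule symI) (simp add: isotopic_sym nrt_op_closed[OF assms])
  show "trans (isotopy_rel G H)"
    unfolding isotopy_rel_def by (rule transI) (simp, meson isotopic_trans)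
qed

end

theory Submission
  imports Defs "HOL-Algebra.Multiplicative_Group"
begin

text \<open>
  Write \<open>a \<sim> b\<close> for congruence modulo the core of \<open>H\<close>, the kernel of the action on the right
  cosets. The existence of a nontrivial permutation \<open>\<sigma>\<close> such that composition with \<open>\<sigma>\<close> permutes
  the right translations of a transversal is invariant under isotopy; in terms of the saturation \<open>M\<close>
  of the transversal under \<open>\<sim>\<close> it says that \<open>M c \<subseteq> M\<close> for some \<open>c \<in> M - H\<close>.
  If \<open>H\<close> is not normal, choose \<open>h \<in> H\<close> and \<open>x\<close> with \<open>x h x\<inverse> \<notin> H\<close>, and by nilpotency some \<open>z \<notin> H\<close> that
  is central modulo the core. There is an \<open>M\<close> with \<open>M z \<subseteq> M\<close>, \<open>x \<in> M\<close> and \<open>x h \<notin> M\<close>. Replacing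
  \<open>z\<close> by \<open>h z\<close> in it gives an \<open>M'\<close> whose only elements \<open>m\<close> with \<open>m z \<notin> M'\<close> are \<open>1\<close> and \<open>h z\<close>
  modulo \<open>\<sim>\<close>. Right multiplication by \<open>c\<close> with \<open>M' c \<subseteq> M'\<close> permutes these elements, so \<open>c \<sim> h z\<close>; but then
  \<open>x h z \<in> M'\<close>, which forces \<open>x h \<in> M\<close>.
\<close>

section \<open>An isotopy invariant of right loops\<close>

definition translations_stabilized :: "'a set \<Rightarrow> ('a \<Rightarrow> 'a \<Rightarrow> 'a) \<Rightarrow> bool" where
  "translations_stabilized S f \<longleftrightarrow>
     (\<exists>\<sigma>. (\<exists>u\<in>S. \<sigma> u \<in> S \<and> \<sigma> u \<noteq> u) \<and> (\<forall>y\<in>S. \<exists>y'\<in>S. \<forall>x\<in>S. \<sigma> (f x y) = f x y'))"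

text \<open>Conjugation by \<gamma> transports \<sigma>. The isotopy turns right translation by
  \<open>y\<close> into right translation by \<open>\<beta> y\<close>, with \<alpha> on the source
  side and \<gamma> on the target side; since \<sigma> is composed on the target side only, \<alpha>
  does not disturb the relation.\<close>

lemma isotopic_translations_stabilized:
  assumes iso: "isotopic S f S' f'"
    and stab: "translations_stabilized S f"
    and closed: "\<And>x y. x \<in> S \<Longrightarrow> y \<in> S \<Longrightarrow> f x y \<in> S"
  shows "translations_stabilized S' f'"
proof -
  obtain \<alpha> \<beta> \<gamma> where b: "bij_betw \<alpha> S S'" "bij_betw \<beta> S S'" "bij_betw \<gamma> S S'"
    and e: "\<And>x y. x \<in> S \<Longrightarrow> y \<in> S \<Longrightarrow> f' (\<alpha> x) (\<beta> y) = \<gamma> (f x y)"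
    using iso unfolding isotopic_def by blast
  obtain \<sigma> u where u: "u \<in> S" "\<sigma> u \<in> S" "\<sigma> u \<noteq> u"
    and s: "\<And>y. y \<in> S \<Longrightarrow> \<exists>y'\<in>S. \<forall>x\<in>S. \<sigma> (f x y) = f x y'"
    using stab unfolding translations_stabilized_def by blast
  define \<sigma>' where "\<sigma>' = (\<lambda>v. \<gamma> (\<sigma> (inv_into S \<gamma> v)))"
  have \<sigma>': "\<sigma>' (\<gamma> v) = \<gamma> (\<sigma> v)" if "v \<in> S" for v
    using that b(3) by (simp add: \<sigma>'_def bij_betw_inv_into_left)
  have "\<gamma> u \<in> S'" "\<sigma>' (\<gamma> u) \<in> S'" "\<sigma>' (\<gamma> u) \<noteq> \<gamma> u"
    using u \<sigma>' b(3) by (auto simp: bij_betw_def inj_on_def)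
  moreover have "\<exists>w'\<in>S'. \<forall>v\<in>S'. \<sigma>' (f' v w) = f' v w'" if w: "w \<in> S'" for w
  proof -
    obtain y where y: "y \<in> S" "w = \<beta> y"
      using w b(2) by (auto simp: bij_betw_def)
    obtain y' where y': "y' \<in> S" "\<And>x. x \<in> S \<Longrightarrow> \<sigma> (f x y) = f x y'"
      using s[OF y(1)] by blast
    have "\<sigma>' (f' v w) = f' v (\<beta> y')" if "v \<in> S'" for v
    proof -
      obtain x where "x \<in> S" "v = \<alpha> x"
        using \<open>v \<in> S'\<close> b(1) by (auto simp: bij_betw_def)
      then show ?thesis
        using y y' by (simp add: e \<sigma>' closed)
    qed
    then show ?thesis
      using y'(1) b(2) by (auto simp: bij_betw_def)
  qed
  ultimately show ?thesis
    unfolding translations_stabilized_def by blast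
qed

lemma isotopic_if_card_Itp_1:
  assumes "group G" "card (Itp G H) = 1" "S \<in> NRTs G H" "S' \<in> NRTs G H"
  shows "isotopic S (nrt_op G H S) S' (nrt_op G H S')"
proof -
  let ?r = "isotopy_rel G H"
  obtain Q where "NRTs G H // ?r = {Q}"
    using assms(2) unfolding Itp_def by (rule card_1_singletonE)
  then have "?r `` {S} = ?r `` {S'}"
    using assms(3,4) by (metis quotientI singletonD)
  then have "(S, S') \<in> ?r"
    using eq_equiv_class[OF _ equiv_isotopy_rel[OF assms(1)] assms(4)] by blast
  then show ?thesis
    by (simp add: isotopy_rel_def)
qed

section \<open>Congruence modulo the core of \<open>H\<close>\<close>

locale group_subgroup = group G for G (structure) +
  fixes H
  assumes subgroup_H: "subgroup H G"
begin

lemma H_subset: "H \<subseteq> carrier G"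
  by (rule subgroup.subset[OF subgroup_H])

text \<open>Stated as equality of the actions on right cosets, which is the form in which it is both
  produced and consumed; the core itself need not be constructed.\<close>

definition core_cong :: "'a \<Rightarrow> 'a \<Rightarrow> bool" (infix "\<sim>" 50) where
  "a \<sim> b \<longleftrightarrow> (\<forall>g\<in>carrier G. H #> (g \<otimes> a) = H #> (g \<otimes> b))"

lemma core_cong_refl [simp]: "a \<sim> a"
  by (simp add: core_cong_def)

lemma core_cong_sym: "a \<sim> b \<Longrightarrow> b \<sim> a"
  by (simp add: core_cong_def)

lemma core_cong_trans [trans]: "a \<sim> b \<Longrightarrow> b \<sim> c \<Longrightarrow> a \<sim> c"
  by (simp add: core_cong_def)

lemma coset_mult_right:
  assumes "H #> a = H #> b" "a \<in> carrier G" "b \<in> carrier G" "c \<in> carrier G"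
  shows "H #> (a \<otimes> c) = H #> (b \<otimes> c)"
  using assms H_subset by (metis coset_mult_assoc)

lemma coset_cancel_right:
  assumes "H #> (a \<otimes> c) = H #> (b \<otimes> c)" "a \<in> carrier G" "b \<in> carrier G" "c \<in> carrier G"
  shows "H #> a = H #> b"
  using coset_mult_right[OF assms(1), of "inv c"] assms(2-) by (simp add: m_assoc)

lemma coset_mult_left_H:
  assumes "h \<in> H" "a \<in> carrier G"
  shows "H #> (h \<otimes> a) = H #> a"
proof -
  have "H #> h = H"
    using subgroup.rcos_const[OF subgroup_H is_group assms(1)] .
  then show ?thesis
    using assms H_subset by (metis coset_mult_assoc subsetD)
qed

lemma coset_eq_H_iff: "a \<in> carrier G \<Longrightarrow> H #> a = H #> \<one> \<longleftrightarrow> a \<in> H"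
  using coset_join1[of H a, OF _ _ subgroup_H] coset_join2[of a H, OF _ subgroup_H] H_subset
  by auto

lemma coset_eqD:
  assumes "a \<in> H #> b" "b \<in> carrier G"
  shows "H #> a = H #> b"
  using repr_independence[OF assms(1) assms(2) subgroup_H] by simp

lemma mem_coset_iff:
  assumes "a \<in> carrier G" "b \<in> carrier G"
  shows "a \<in> H #> b \<longleftrightarrow> H #> a = H #> b"
  using coset_eqD[OF _ assms(2)] rcos_self[OF assms(1) subgroup_H] by auto

lemma core_cong_coset: "a \<sim> b \<Longrightarrow> a \<in> carrier G \<Longrightarrow> b \<in> carrier G \<Longrightarrow> H #> a = H #> b"
  unfolding core_cong_def by (metis l_one one_closed)

lemma core_cong_mult_right:
  "a \<sim> b \<Longrightarrow> a \<in> carrier G \<Longrightarrow> b \<in> carrier G \<Longrightarrow> c \<in> carrier G \<Longrightarrow> a \<otimes> c \<sim> b \<otimes> c"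
  unfolding core_cong_def using coset_mult_right by (metis m_assoc m_closed)

lemma core_cong_mult_left:
  "a \<sim> b \<Longrightarrow> a \<in> carrier G \<Longrightarrow> b \<in> carrier G \<Longrightarrow> c \<in> carrier G \<Longrightarrow> c \<otimes> a \<sim> c \<otimes> b"
  unfolding core_cong_def by (metis m_assoc m_closed)

lemma core_cong_cancel_right:
  assumes "a \<otimes> c \<sim> b \<otimes> c" "a \<in> carrier G" "b \<in> carrier G" "c \<in> carrier G"
  shows "a \<sim> b"
  using core_cong_mult_right[OF assms(1), of "inv c"] assms(2-) by (simp add: m_assoc)

lemma core_cong_cancel_left:
  assumes "c \<otimes> a \<sim> c \<otimes> b" "a \<in> carrier G" "b \<in> carrier G" "c \<in> carrier G"
  shows "a \<sim> b"
  using core_cong_mult_left[OF assms(1), of "inv c"] assms(2-) by (simp flip: m_assoc)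

section \<open>Elements that are central modulo the core\<close>

definition core_central :: "'a \<Rightarrow> bool" where
  "core_central u \<longleftrightarrow> u \<in> carrier G \<and> (\<forall>g\<in>carrier G. u \<otimes> g \<sim> g \<otimes> u)"

lemma core_central_closed: "core_central u \<Longrightarrow> u \<in> carrier G"
  by (simp add: core_central_def)

lemma core_central_comm: "core_central u \<Longrightarrow> g \<in> carrier G \<Longrightarrow> u \<otimes> g \<sim> g \<otimes> u"
  by (simp add: core_central_def)

lemma core_central_mult:
  assumes u: "core_central u" and v: "core_central v"
  shows "core_central (u \<otimes> v)"
proof -
  note c = core_central_closed[OF u] core_central_closed[OF v]
  have "u \<otimes> v \<otimes> g \<sim> g \<otimes> (u \<otimes> v)" if g: "g \<in> carrier G" for g
  proof -
    have "u \<otimes> (v \<otimes> g) \<sim> u \<otimes> (g \<otimes> v)"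
      using core_central_comm[OF v g] c g by (intro core_cong_mult_left) auto
    also have "u \<otimes> (g \<otimes> v) = u \<otimes> g \<otimes> v"
      using c g by (simp add: m_assoc)
    also have "\<dots> \<sim> g \<otimes> u \<otimes> v"
      using core_central_comm[OF u g] c g by (intro core_cong_mult_right) auto
    finally show ?thesis
      using c g by (simp add: m_assoc)
  qed
  then show ?thesis
    using c by (simp add: core_central_def)
qed

lemma core_central_inv:
  assumes u: "core_central u"
  shows "core_central (inv u)"
proof -
  note c = core_central_closed[OF u]
  have "inv u \<otimes> g \<sim> g \<otimes> inv u" if g: "g \<in> carrier G" for g
  proof -
    have "u \<otimes> (g \<otimes> inv u) \<sim> (g \<otimes> inv u) \<otimes> u"
      using c g by (intro core_central_comm[OF u]) auto
    also have "\<dots> = u \<otimes> (inv u \<otimes> g)"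
      using c g by (simp add: m_assoc) (simp flip: m_assoc)
    finally show ?thesis
      using core_cong_cancel_left[THEN core_cong_sym] c g by blast
  qed
  then show ?thesis
    using c by (simp add: core_central_def)
qed

lemma core_central_int_pow:
  assumes u: "core_central u"
  shows "core_central (u [^] (i::int))"
proof -
  have nat: "core_central (u [^] (n::nat))" for n
  proof (induction n)
    case 0
    then show ?case
      by (simp add: core_central_def)
  next
    case (Suc n)
    then show ?case
      using core_central_mult[OF _ u] by simp
  qed
  show ?thesis
    using core_central_inv[OF nat] nat unfolding int_pow_def2 by presburger
qed

text \<open>The action of \<open>u\<close> commutes with the transitive action of \<open>G\<close>
  on the right cosets, so fixing one coset means fixing all of them.\<close>

lemma core_central_fix_coset:
  assumes u: "core_central u" and g: "g \<in> carrier G" and eq: "H #> (g \<otimes> u) = H #> g"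
  shows "u \<sim> \<one>"
proof -
  note c = core_central_closed[OF u]
  have comm: "H #> (u \<otimes> k) = H #> (k \<otimes> u)" if "k \<in> carrier G" for k
    using core_cong_coset[OF core_central_comm[OF u that]] c that by simp
  have "H #> u = H #> \<one>"
    using coset_cancel_right[of u g "\<one>"] comm[OF g] eq c g by simp
  then have "H #> (k \<otimes> u) = H #> k" if "k \<in> carrier G" for k
    using coset_mult_right[of u "\<one>" k] comm[OF that] c that by simp
  then show ?thesis
    by (simp add: core_cong_def)
qed

section \<open>Transversals saturated under congruence modulo the core\<close>

text \<open>Such an \<open>M\<close> meets every right coset in exactly one class of \<sim>.
  Stability under right multiplication is a property of these classes, whatever representatives an
  NRT inside \<open>M\<close> picks.\<close>

definition core_transversal :: "'a set \<Rightarrow> bool" where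
  "core_transversal M \<longleftrightarrow> M \<subseteq> carrier G \<and> \<one> \<in> M \<and>
     (\<forall>g\<in>carrier G. \<exists>m\<in>M. H #> m = H #> g) \<and>
     (\<forall>m\<in>M. \<forall>m'\<in>M. H #> m = H #> m' \<longrightarrow> m \<sim> m') \<and>
     (\<forall>m\<in>M. \<forall>g\<in>carrier G. m \<sim> g \<longrightarrow> g \<in> M)"

lemma core_transversalD:
  assumes "core_transversal M"
  shows "m \<in> M \<Longrightarrow> m \<in> carrier G" "\<one> \<in> M"
    "g \<in> carrier G \<Longrightarrow> \<exists>m\<in>M. H #> m = H #> g"
    "m \<in> M \<Longrightarrow> m' \<in> M \<Longrightarrow> H #> m = H #> m' \<Longrightarrow> m \<sim> m'"
    "m \<in> M \<Longrightarrow> g \<in> carrier G \<Longrightarrow> m \<sim> g \<Longrightarrow> g \<in> M"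
  using assms unfolding core_transversal_def by blast+

lemma ex_NRT_subset:
  assumes M: "core_transversal M"
  obtains S where "S \<in> NRTs G H" "S \<subseteq> M"
proof -
  note M' = core_transversalD[OF M]
  \<comment> \<open>The coset \<open>H\<close> is treated separately because the transversal has to
    be normalized.\<close>
  define e where "e C = (if C = H #> \<one> then \<one> else SOME m. m \<in> M \<and> H #> m = C)" for C
  have e: "e (H #> g) \<in> M" "H #> e (H #> g) = H #> g" if "g \<in> carrier G" for g
    using someI_ex[of "\<lambda>m. m \<in> M \<and> H #> m = H #> g"] M'(2,3) that by (auto simp: e_def)
  define S where "S = (\<lambda>g. e (H #> g)) ` carrier G"
  have SM: "S \<subseteq> M"
    using e by (auto simp: S_def)
  have "\<exists>!s. s \<in> (H #> g) \<inter> S" if g: "g \<in> carrier G" for g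
  proof (intro ex1I)
    show "e (H #> g) \<in> (H #> g) \<inter> S"
      using e[OF g] g M'(1) by (auto simp: S_def mem_coset_iff)
  next
    fix s assume s: "s \<in> (H #> g) \<inter> S"
    then obtain k where k: "k \<in> carrier G" "s = e (H #> k)"
      by (auto simp: S_def)
    have "H #> s = H #> g"
      using s coset_eqD[OF _ g] by blast
    then have "H #> k = H #> g"
      using k e by simp
    then show "s = e (H #> g)"
      using k by simp
  qed
  moreover have "\<one> \<in> S"
    by (auto simp: S_def e_def image_iff intro!: bexI[of _ "\<one>"])
  ultimately have "S \<in> NRTs G H"
    using SM M'(1) by (auto simp: NRTs_def RCOSETS_def)
  then show ?thesis
    using SM that by blast
qed

lemma NRT_rep:
  assumes S: "S \<in> NRTs G H" and g: "g \<in> carrier G"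
  shows "the_elem ((H #> g) \<inter> S) \<in> S" "H #> the_elem ((H #> g) \<inter> S) = H #> g"
proof -
  have "H #> g \<in> rcosets H"
    using g by (auto simp: RCOSETS_def)
  then have "\<exists>!s. s \<in> (H #> g) \<inter> S"
    using S by (simp add: NRTs_def)
  then obtain s where s: "(H #> g) \<inter> S = {s}"
    by blast
  then show "the_elem ((H #> g) \<inter> S) \<in> S"
    by auto
  show "H #> the_elem ((H #> g) \<inter> S) = H #> g"
    using s g coset_eqD[of s g] by auto
qed

lemma NRT_eqI:
  assumes S: "S \<in> NRTs G H" and "s \<in> S" "t \<in> S" "H #> s = H #> t"
  shows "s = t"
proof -
  have c: "s \<in> carrier G" "t \<in> carrier G"
    using assms by (auto simp: NRTs_def)
  then have "H #> t \<in> rcosets H"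
    by (auto simp: RCOSETS_def)
  then have "\<exists>!s. s \<in> (H #> t) \<inter> S"
    using S by (simp add: NRTs_def)
  then show ?thesis
    using assms c by (metis Int_iff mem_coset_iff)
qed

lemma nrt_op_coset:
  assumes "S \<in> NRTs G H" "s \<in> S" "t \<in> S"
  shows "nrt_op G H S s t \<in> S" "H #> nrt_op G H S s t = H #> (s \<otimes> t)"
  using NRT_rep[OF assms(1), of "s \<otimes> t"] assms
  by (auto simp: nrt_op_def NRTs_def subset_iff)

text \<open>The permutation is right multiplication by \<open>c\<close> on cosets, read off on
  representatives; it moves \<one> because \<open>c\<close> lies outside \<open>H\<close>.\<close>

lemma translations_stabilizedI:
  assumes M: "core_transversal M" and S: "S \<in> NRTs G H" "S \<subseteq> M"
    and c: "c \<in> carrier G" "c \<notin> H" "\<And>m. m \<in> M \<Longrightarrow> m \<otimes> c \<in> M"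
  shows "translations_stabilized S (nrt_op G H S)"
proof -
  note M' = core_transversalD[OF M]
  have SG: "s \<in> carrier G" if "s \<in> S" for s
    using S that M'(1) by blast
  have one: "\<one> \<in> S"
    using S by (simp add: NRTs_def)
  define \<sigma> where "\<sigma> = (\<lambda>s. the_elem ((H #> (s \<otimes> c)) \<inter> S))"
  have \<sigma>: "\<sigma> s \<in> S" "H #> \<sigma> s = H #> (s \<otimes> c)" if "s \<in> S" for s
    using NRT_rep[OF S(1), of "s \<otimes> c"] SG[OF that] c by (simp_all add: \<sigma>_def)
  have "\<sigma> \<one> \<noteq> \<one>"
    using \<sigma>(2)[OF one] c coset_eq_H_iff[OF c(1)] by auto
  moreover have "\<sigma> (nrt_op G H S x y) = nrt_op G H S x (\<sigma> y)" if x: "x \<in> S" and y: "y \<in> S" for x y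
  proof -
    \<comment> \<open>Both sides lie in \<open>M\<close> and in the same coset. Equality of cosets
      alone would not survive left multiplication by \<open>x\<close>; congruence does.\<close>
    have "\<sigma> y \<sim> y \<otimes> c"
      using M'(4) \<sigma>[OF y] S(2) c(3) y by blast
    then have xy: "H #> (x \<otimes> \<sigma> y) = H #> (x \<otimes> (y \<otimes> c))"
      using SG[OF x] by (simp add: core_cong_def)
    have "H #> (nrt_op G H S x y \<otimes> c) = H #> (x \<otimes> y \<otimes> c)"
      using nrt_op_coset[OF S(1) x y] SG x y c by (intro coset_mult_right) auto
    also have "\<dots> = H #> (x \<otimes> \<sigma> y)"
      using xy SG x y c by (simp add: m_assoc)
    finally show ?thesis
      by (simp add: \<sigma>_def nrt_op_def)
  qed
  ultimately show ?thesis
    unfolding translations_stabilized_def using one \<sigma>(1) by blast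
qed

text \<open>Since \<one> is a right identity, \<sigma> is itself a right translation, by some
  \<open>c\<close>. That \<sigma> carries translations to translations then says that
  \<open>y \<otimes> c\<close> acts on cosets like an element of \<open>S\<close>.\<close>

lemma translations_stabilizedD:
  assumes M: "core_transversal M" and S: "S \<in> NRTs G H" "S \<subseteq> M"
    and stab: "translations_stabilized S (nrt_op G H S)"
  obtains c where "c \<in> M" "c \<notin> H" "\<And>m. m \<in> M \<Longrightarrow> m \<otimes> c \<in> M"
proof -
  note M' = core_transversalD[OF M]
  let ?f = "nrt_op G H S"
  have SG: "s \<in> carrier G" if "s \<in> S" for s
    using S that M'(1) by blast
  have one: "\<one> \<in> S"
    using S by (simp add: NRTs_def)
  have f_one: "?f x \<one> = x" if "x \<in> S" for x
    using nrt_op_coset[OF S(1) that one] SG[OF that] that by (intro NRT_eqI[OF S(1)]) auto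
  obtain \<sigma> u where u: "u \<in> S" "\<sigma> u \<noteq> u"
    and s: "\<And>y. y \<in> S \<Longrightarrow> \<exists>y'\<in>S. \<forall>x\<in>S. \<sigma> (?f x y) = ?f x y'"
    using stab unfolding translations_stabilized_def by blast
  obtain c where c: "c \<in> S" "\<And>x. x \<in> S \<Longrightarrow> \<sigma> x = ?f x c"
    using s[OF one] f_one by auto
  have "c \<notin> H"
  proof
    assume "c \<in> H"
    then have "c = \<one>"
      using c(1) one SG by (intro NRT_eqI[OF S(1)]) (auto simp: coset_eq_H_iff)
    then show False
      using c(2)[OF u(1)] u f_one by simp
  qed
  moreover have "m \<otimes> c \<in> M" if m: "m \<in> M" for m
  proof -
    define y where "y = the_elem ((H #> m) \<inter> S)"
    have y: "y \<in> S" "H #> y = H #> m"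
      unfolding y_def using NRT_rep[OF S(1) M'(1)[OF m]] by auto
    have ym: "y \<sim> m"
      using M'(4) y S m by blast
    obtain y' where y': "y' \<in> S" "\<And>x. x \<in> S \<Longrightarrow> \<sigma> (?f x y) = ?f x y'"
      using s[OF y(1)] by blast
    have S_eq: "H #> (x \<otimes> (y \<otimes> c)) = H #> (x \<otimes> y')" if x: "x \<in> S" for x
    proof -
      have xy: "?f x y \<in> S" "H #> ?f x y = H #> (x \<otimes> y)"
        using nrt_op_coset[OF S(1) x y(1)] by auto
      have "H #> (x \<otimes> y \<otimes> c) = H #> (?f x y \<otimes> c)"
        using xy SG x y c by (intro coset_mult_right) auto
      also have "\<dots> = H #> ?f (?f x y) c"
        using nrt_op_coset[OF S(1) xy(1) c(1)] by simp
      also have "\<dots> = H #> (x \<otimes> y')"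
        using c(2)[OF xy(1)] y'(2)[OF x] nrt_op_coset[OF S(1) x y'(1)] by simp
      finally show ?thesis
        using SG x y c by (simp add: m_assoc)
    qed
    \<comment> \<open>\<open>S\<close> meets every right coset, so agreement after left
      multiplication by elements of \<open>S\<close> is agreement of the actions on all
      cosets.\<close>
    have "y \<otimes> c \<sim> y'"
      unfolding core_cong_def
    proof
      fix g assume g: "g \<in> carrier G"
      obtain x where x: "x \<in> S" "H #> x = H #> g"
        using NRT_rep[OF S(1) g] by blast
      have "H #> (g \<otimes> w) = H #> (x \<otimes> w)" if "w \<in> carrier G" for w
        using coset_mult_right[OF x(2)[symmetric]] SG x g that by simp
      then show "H #> (g \<otimes> (y \<otimes> c)) = H #> (g \<otimes> y')"
        using S_eq[OF x(1)] SG y y' c by simp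
    qed
    then have "y' \<sim> m \<otimes> c"
      using core_cong_mult_right[OF ym, of c] SG y c M'(1)[OF m]
      by (meson core_cong_sym core_cong_trans)
    then show ?thesis
      using M'(5)[of y' "m \<otimes> c"] y' S SG c M'(1)[OF m] by auto
  qed
  ultimately show ?thesis
    using that c(1) S(2) by blast
qed

end

section \<open>A saturated transversal stable under \<open>z\<close> that contains \<open>x\<close>
  but not \<open>x \<otimes> h\<close>\<close>

locale non_normal_central = group_subgroup +
  fixes z x h
  assumes z: "core_central z" "z \<notin> H"
    and x: "x \<in> carrier G" and h: "h \<in> H" and xh: "H #> (x \<otimes> h) \<noteq> H #> x"
begin

lemma closed [simp, intro]: "z \<in> carrier G" "x \<in> carrier G" "h \<in> carrier G" "z [^] (i::int) \<in> carrier G"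
  using z x h H_subset by (auto simp: core_central_def)

lemma h_not_cong_one: "\<not> h \<sim> \<one>"
  using xh x unfolding core_cong_def by fastforce

lemma z_pow_cong_one: "g \<in> carrier G \<Longrightarrow> H #> (g \<otimes> z [^] (i::int)) = H #> g \<Longrightarrow> z [^] i \<sim> \<one>"
  by (rule core_central_fix_coset[OF core_central_int_pow[OF z(1)]])

lemma coset_h_z_pow: "k \<in> H \<Longrightarrow> H #> (z [^] (i::int) \<otimes> k) = H #> z [^] i"
proof -
  assume k: "k \<in> H"
  then have "k \<in> carrier G"
    using H_subset by blast
  then show ?thesis
    using core_cong_coset[OF core_central_comm[OF core_central_int_pow[OF z(1)], of k i]]
    by (simp add: coset_mult_left_H k)
qed

text \<open>Elements of \<open>H\<close> fix each coset of a power of \<open>z\<close>, whereas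
  \<open>h\<close> moves the coset of \<open>x\<close>.\<close>

lemma x_not_z_pow: "H #> x \<noteq> H #> z [^] (i::int)"
proof
  assume eq: "H #> x = H #> z [^] i"
  have "H #> (x \<otimes> h) = H #> (z [^] i \<otimes> h)"
    by (rule coset_mult_right[OF eq]) (rule closed)+
  then show False
    using eq xh coset_h_z_pow[OF h, of i] by metis
qed

lemma xh_not_z_pow: "H #> (x \<otimes> h) \<noteq> H #> z [^] (i::int)"
proof
  assume "H #> (x \<otimes> h) = H #> z [^] i"
  then have "H #> (x \<otimes> h) = H #> (z [^] i \<otimes> h)"
    using coset_h_z_pow[OF h] by simp
  then show False
    using coset_cancel_right[of x h "z [^] i"] x_not_z_pow by simp
qed

text \<open>The union of the cosets in the orbit of \<open>H #> g\<close> under the cyclic group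
  generated by \<open>z\<close>. Integer exponents make this symmetric without assuming finite
  order.\<close>

definition orbit :: "'a \<Rightarrow> 'a set" where
  "orbit g = {k \<in> carrier G. \<exists>i::int. H #> k = H #> (g \<otimes> z [^] i)}"

lemma orbitI: "k \<in> carrier G \<Longrightarrow> H #> k = H #> (g \<otimes> z [^] (i::int)) \<Longrightarrow> k \<in> orbit g"
  unfolding orbit_def by blast

lemma orbit_subset:
  assumes "k \<in> orbit g" "g \<in> carrier G"
  shows "orbit k \<subseteq> orbit g"
proof
  fix l assume l: "l \<in> orbit k"
  obtain i where i: "k \<in> carrier G" "H #> k = H #> (g \<otimes> z [^] (i::int))"
    using assms by (auto simp: orbit_def)
  obtain j where j: "l \<in> carrier G" "H #> l = H #> (k \<otimes> z [^] (j::int))"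
    using l by (auto simp: orbit_def)
  have "H #> (k \<otimes> z [^] j) = H #> (g \<otimes> z [^] i \<otimes> z [^] j)"
    using i assms by (intro coset_mult_right) auto
  also have "g \<otimes> z [^] i \<otimes> z [^] j = g \<otimes> z [^] (i + j)"
    using assms by (simp add: m_assoc int_pow_mult)
  finally show "l \<in> orbit g"
    using j by (auto simp: orbit_def)
qed

lemma orbit_sym:
  assumes "k \<in> orbit g" "g \<in> carrier G"
  shows "g \<in> orbit k"
proof -
  obtain i where i: "k \<in> carrier G" "H #> k = H #> (g \<otimes> z [^] (i::int))"
    using assms by (auto simp: orbit_def)
  have "H #> (k \<otimes> z [^] (- i)) = H #> (g \<otimes> z [^] i \<otimes> z [^] (- i))"
    using i assms by (intro coset_mult_right) auto
  also have "g \<otimes> z [^] i \<otimes> z [^] (- i) = g"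
    using assms by (simp add: m_assoc flip: int_pow_mult)
  finally show ?thesis
    using assms unfolding orbit_def by auto
qed

lemma orbit_eq: "k \<in> orbit g \<Longrightarrow> g \<in> carrier G \<Longrightarrow> orbit k = orbit g"
  using orbit_subset orbit_sym by (metis (no_types, lifting) mem_Collect_eq orbit_def subset_antisym)

lemma orbit_mult_z_pow: "g \<in> carrier G \<Longrightarrow> orbit (g \<otimes> z [^] (i::int)) = orbit g"
  by (rule orbit_eq) (auto simp: orbit_def)

lemma orbit_coset: "g \<in> carrier G \<Longrightarrow> k \<in> carrier G \<Longrightarrow> H #> k = H #> g \<Longrightarrow> orbit k = orbit g"
  using orbit_eq[OF orbitI[of k g 0]] by simp

lemma orbit_refl: "g \<in> carrier G \<Longrightarrow> g \<in> orbit g"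
  by (rule orbitI[of _ _ 0]) simp_all

text \<open>Picking \<open>h x h\<close> instead of \<open>x h\<close> is what keeps \<open>x h\<close> out of the transversal below.\<close>

definition base :: "'a set \<Rightarrow> 'a" where
  "base C = (if \<one> \<in> C then \<one> else if x \<in> C then x else if x \<otimes> h \<in> C then h \<otimes> (x \<otimes> h)
             else SOME k. k \<in> C)"

lemma base_in_orbit:
  assumes "g \<in> carrier G"
  shows "base (orbit g) \<in> orbit g"
proof -
  have "h \<otimes> (x \<otimes> h) \<in> orbit g" if "x \<otimes> h \<in> orbit g"
    using that by (auto simp: orbit_def coset_mult_left_H h)
  then show ?thesis
    using someI[of "\<lambda>k. k \<in> orbit g", OF orbit_refl[OF assms]] by (auto simp: base_def)
qed

text \<open>One base point is chosen per orbit and spread by powers of \<open>z\<close>, so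
  stability under \<open>z\<close> is built in.\<close>

definition z_transversal :: "'a set" where
  "z_transversal = {g \<in> carrier G. \<exists>i::int. g \<sim> base (orbit g) \<otimes> z [^] i}"

lemma base_closed [simp, intro]: "g \<in> carrier G \<Longrightarrow> base (orbit g) \<in> carrier G"
  using base_in_orbit by (auto simp: orbit_def)

lemma z_transversal_mult:
  assumes "m \<in> z_transversal"
  shows "m \<otimes> z [^] (j::int) \<in> z_transversal"
proof -
  obtain i where m: "m \<in> carrier G" and i: "m \<sim> base (orbit m) \<otimes> z [^] (i::int)"
    using assms by (auto simp: z_transversal_def)
  have "m \<otimes> z [^] j \<sim> base (orbit m) \<otimes> z [^] i \<otimes> z [^] j"
    using m i by (intro core_cong_mult_right) auto
  also have "base (orbit m) \<otimes> z [^] i \<otimes> z [^] j = base (orbit m) \<otimes> z [^] (i + j)"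
    using m by (simp add: m_assoc int_pow_mult)
  finally show ?thesis
    using m by (auto simp: z_transversal_def orbit_mult_z_pow)
qed

lemma one_in_z_transversal: "\<one> \<in> z_transversal"
  using orbit_refl[of "\<one>"]
  by (auto simp: z_transversal_def base_def intro!: exI[of _ "0::int"])

text \<open>This rules out the first branch of \<open>base\<close> on the orbits of \<open>x\<close>
  and \<open>x \<otimes> h\<close>.\<close>

lemma one_notin_orbit: "\<one> \<notin> orbit x" "\<one> \<notin> orbit (x \<otimes> h)"
  using orbit_sym[of "\<one>" x] orbit_sym[of "\<one>" "x \<otimes> h"] x_not_z_pow xh_not_z_pow
  by (auto simp: orbit_def)

lemma x_in_z_transversal: "x \<in> z_transversal"
  using orbit_refl[of x] one_notin_orbit(1)
  by (auto simp: z_transversal_def base_def intro!: exI[of _ "0::int"])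

text \<open>Whether the base point is \<open>x\<close> or
  \<open>h \<otimes> (x \<otimes> h)\<close>, membership makes a power of \<open>z\<close> fix a
  coset. That power is then trivial modulo the core, and cancelling leaves
  \<open>h \<sim> \<one>\<close>.\<close>

lemma xh_notin_z_transversal: "x \<otimes> h \<notin> z_transversal"
proof
  assume "x \<otimes> h \<in> z_transversal"
  then obtain i where i: "x \<otimes> h \<sim> base (orbit (x \<otimes> h)) \<otimes> z [^] (i::int)"
    by (auto simp: z_transversal_def)
  show False
  proof (cases "x \<in> orbit (x \<otimes> h)")
    case True
    then have "x \<otimes> h \<sim> x \<otimes> z [^] i"
      using i one_notin_orbit by (simp add: base_def)
    then have hz: "h \<sim> z [^] i"
      by (rule core_cong_cancel_left) auto
    then have "H #> (\<one> \<otimes> z [^] i) = H #> \<one>"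
      using core_cong_coset[OF hz] coset_eq_H_iff[of h] h by auto
    then have "z [^] i \<sim> \<one>"
      by (intro z_pow_cong_one[of "\<one>"]) auto
    then show False
      using hz h_not_cong_one core_cong_trans by blast
  next
    case False
    then have *: "x \<otimes> h \<sim> h \<otimes> (x \<otimes> h) \<otimes> z [^] i"
      using i one_notin_orbit orbit_refl[of "x \<otimes> h"] by (simp add: base_def)
    have "H #> (x \<otimes> h \<otimes> z [^] i) = H #> (x \<otimes> h)"
      using core_cong_coset[OF *] coset_mult_left_H[OF h, of "x \<otimes> h \<otimes> z [^] i"]
      by (simp add: m_assoc)
    then have "z [^] i \<sim> \<one>"
      by (intro z_pow_cong_one[of "x \<otimes> h"]) auto
    then have "h \<otimes> (x \<otimes> h) \<otimes> z [^] i \<sim> h \<otimes> (x \<otimes> h) \<otimes> \<one>"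
      by (intro core_cong_mult_left) auto
    with * have "x \<otimes> h \<sim> h \<otimes> (x \<otimes> h)"
      using core_cong_trans by fastforce
    then have "\<one> \<otimes> (x \<otimes> h) \<sim> h \<otimes> (x \<otimes> h)"
      by simp
    then have "\<one> \<sim> h"
      by (rule core_cong_cancel_right) auto
    then show False
      using h_not_cong_one core_cong_sym by blast
  qed
qed

lemma core_transversal_z_transversal: "core_transversal z_transversal"
  unfolding core_transversal_def
proof (intro conjI ballI impI)
  show "z_transversal \<subseteq> carrier G"
    by (auto simp: z_transversal_def)
  show "\<one> \<in> z_transversal"
    by (rule one_in_z_transversal)
next
  fix g assume g: "g \<in> carrier G"
  let ?t = "base (orbit g)"
  obtain i where i: "H #> g = H #> (?t \<otimes> z [^] (i::int))"
    using orbit_sym[OF base_in_orbit[OF g] g] by (auto simp: orbit_def)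
  \<comment> \<open>Membership refers to the base point of the element's own orbit, which must be
    identified with \<open>?t\<close>.\<close>
  then have "orbit (?t \<otimes> z [^] i) = orbit g"
    using g by (intro orbit_coset) auto
  then have "?t \<otimes> z [^] i \<in> z_transversal"
    using g by (auto simp: z_transversal_def intro: exI[of _ i])
  then show "\<exists>m\<in>z_transversal. H #> m = H #> g"
    using i by auto
next
  fix m m' assume mm: "m \<in> z_transversal" "m' \<in> z_transversal" "H #> m = H #> m'"
  then have c: "m \<in> carrier G" "m' \<in> carrier G"
    by (auto simp: z_transversal_def)
  define t where "t = base (orbit m)"
  have t: "t \<in> carrier G" "base (orbit m') = t"
    using c mm orbit_coset[of m' m] by (simp_all add: t_def)
  obtain i j where i: "m \<sim> t \<otimes> z [^] (i::int)" and j: "m' \<sim> t \<otimes> z [^] (j::int)"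
    using mm t by (auto simp: z_transversal_def t_def)
  have "H #> (t \<otimes> z [^] i) = H #> (t \<otimes> z [^] j)"
    using core_cong_coset[OF i] core_cong_coset[OF j] mm c t by simp
  \<comment> \<open>Splitting off \<open>z [^] j\<close> shows that \<open>z [^] (i - j)\<close>
    fixes the coset of \<open>t\<close>, hence is trivial modulo the core.\<close>
  moreover have ij: "z [^] i = z [^] (i - j) \<otimes> z [^] j"
    by (simp flip: int_pow_mult)
  ultimately have "H #> (t \<otimes> z [^] (i - j) \<otimes> z [^] j) = H #> (t \<otimes> z [^] j)"
    using t by (simp add: m_assoc)
  then have "H #> (t \<otimes> z [^] (i - j)) = H #> t"
    by (rule coset_cancel_right) (auto simp: t)
  then have "z [^] (i - j) \<sim> \<one>"
    by (rule z_pow_cong_one[OF t(1)])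
  then have "z [^] i \<sim> \<one> \<otimes> z [^] j"
    unfolding ij by (rule core_cong_mult_right) auto
  then have "t \<otimes> z [^] i \<sim> t \<otimes> z [^] j"
    using core_cong_mult_left[of "z [^] i" "z [^] j" t] t by simp
  then show "m \<sim> m'"
    using i j core_cong_sym core_cong_trans by blast
next
  fix m g assume m: "m \<in> z_transversal" and g: "g \<in> carrier G" "m \<sim> g"
  then have mc: "m \<in> carrier G"
    by (auto simp: z_transversal_def)
  then have "orbit m = orbit g"
    using core_cong_coset g by (intro orbit_coset) auto
  then obtain i where "m \<sim> base (orbit g) \<otimes> z [^] (i::int)"
    using m by (auto simp: z_transversal_def)
  then have "g \<sim> base (orbit g) \<otimes> z [^] i"
    by (rule core_cong_trans[OF core_cong_sym[OF g(2)]])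
  then show "g \<in> z_transversal"
    using g(1) by (auto simp: z_transversal_def)
qed

section \<open>Exchanging the class of \<open>z\<close> for that of \<open>h \<otimes> z\<close>
  within the same coset\<close>

definition modified_transversal :: "'a set" where
  "modified_transversal = {g \<in> z_transversal. H #> g \<noteq> H #> z} \<union> {g \<in> carrier G. g \<sim> h \<otimes> z}"

lemma coset_hz: "g \<in> carrier G \<Longrightarrow> g \<sim> h \<otimes> z \<Longrightarrow> H #> g = H #> z"
  using core_cong_coset[of g "h \<otimes> z"] coset_mult_left_H[OF h, of z] by simp

lemma core_transversal_modified: "core_transversal modified_transversal"
  unfolding core_transversal_def
proof (intro conjI ballI impI)
  note M' = core_transversalD[OF core_transversal_z_transversal]
  show "modified_transversal \<subseteq> carrier G"
    using M'(1) by (auto simp: modified_transversal_def)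
  show "\<one> \<in> modified_transversal"
    using M'(2) z coset_eq_H_iff[of z] by (auto simp: modified_transversal_def)
  {
    fix g assume g: "g \<in> carrier G"
    show "\<exists>m\<in>modified_transversal. H #> m = H #> g"
    proof (cases "H #> g = H #> z")
      case True
      then show ?thesis
        by (intro bexI[of _ "h \<otimes> z"]) (auto simp: modified_transversal_def coset_hz)
    next
      case False
      then show ?thesis
        using M'(3)[OF g] by (auto simp: modified_transversal_def)
    qed
  next
    fix m m' assume "m \<in> modified_transversal" "m' \<in> modified_transversal" "H #> m = H #> m'"
    then show "m \<sim> m'"
      unfolding modified_transversal_def
      using M'(4) coset_hz by (blast intro: core_cong_sym core_cong_trans)
  next
    fix m g assume m: "m \<in> modified_transversal" and g: "g \<in> carrier G" "m \<sim> g"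
    from m consider "m \<in> z_transversal" "H #> m \<noteq> H #> z" | "m \<sim> h \<otimes> z"
      unfolding modified_transversal_def by blast
    then show "g \<in> modified_transversal"
    proof cases
      case 1
      then have "H #> g \<noteq> H #> z"
        using core_cong_coset[OF g(2)] M'(1) g(1) by metis
      then show ?thesis
        using M'(5)[OF 1(1) g] unfolding modified_transversal_def by blast
    next
      case 2
      then have "g \<sim> h \<otimes> z"
        by (rule core_cong_trans[OF core_cong_sym[OF g(2)]])
      then show ?thesis
        using g(1) unfolding modified_transversal_def by blast
    qed
  }
qed

lemma modified_transversal_not_stable:
  assumes fin: "finite (carrier G)"
    and c: "c \<in> modified_transversal" "c \<notin> H"
    and stable: "\<And>m. m \<in> modified_transversal \<Longrightarrow> m \<otimes> c \<in> modified_transversal"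
  shows False
proof -
  let ?M = z_transversal and ?M' = modified_transversal
  note M = core_transversalD[OF core_transversal_z_transversal]
  note M' = core_transversalD[OF core_transversal_modified]
  note cG = M'(1)[OF c(1)]
  have pow: "m \<otimes> c [^] (n::nat) \<in> ?M'" if "m \<in> ?M'" for m n
  proof (induction n)
    case 0
    then show ?case
      using that M'(1) by simp
  next
    case (Suc n)
    then show ?case
      using stable[OF Suc] M'(1)[OF that] cG by (simp add: m_assoc)
  qed
  \<comment> \<open>Finiteness enters here: the inverse of \<open>c\<close> is the power with
    exponent \<open>order G - 1\<close>, so stability under \<open>c\<close> also holds
    backwards.\<close>
  have cancel: "m \<in> ?M'" if "m \<otimes> c \<in> ?M'" "m \<in> carrier G" for m
  proof -
    have "m \<otimes> c \<otimes> c [^] (order G - 1) \<in> ?M'"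
      by (rule pow[OF that(1)])
    moreover have "c \<otimes> c [^] (order G - 1) = \<one>"
      using pow_order_eq_1[OF cG] order_gt_0_iff_finite fin nat_pow_Suc2[OF cG]
      by (metis Suc_diff_1)
    ultimately show ?thesis
      using that cG by (simp add: m_assoc)
  qed
  have "\<not> z \<sim> h \<otimes> z"
  proof
    assume "z \<sim> h \<otimes> z"
    then have "\<one> \<otimes> z \<sim> h \<otimes> z"
      by simp
    then have "\<one> \<sim> h"
      by (rule core_cong_cancel_right) auto
    then show False
      using h_not_cong_one core_cong_sym by blast
  qed
  then have "z \<notin> ?M'"
    by (auto simp: modified_transversal_def)
  then have "z \<otimes> c \<notin> ?M'"
    using cancel by auto
  \<comment> \<open>Centrality of \<open>z\<close> modulo the core swaps the factors, so
    \<open>c\<close> is an element of the modified transversal that right multiplication by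
    \<open>z\<close> throws out.\<close>
  then have cz: "c \<otimes> z \<notin> ?M'"
    using M'(5)[of "c \<otimes> z" "z \<otimes> c"] core_cong_sym[OF core_central_comm[OF z(1) cG]] cG by auto
  have "c \<sim> h \<otimes> z"
  proof (rule ccontr)
    assume "\<not> c \<sim> h \<otimes> z"
    then have "c \<in> ?M"
      using c by (auto simp: modified_transversal_def)
    then have "c \<otimes> z \<in> ?M"
      using z_transversal_mult[of c 1] by simp
    \<comment> \<open>The exchange affects only the coset of \<open>z\<close>, and
      \<open>c \<otimes> z\<close> lies there only if \<open>c\<close> is in
      \<open>H\<close>.\<close>
    moreover have "H #> (c \<otimes> z) \<noteq> H #> z"
      using coset_cancel_right[of c z "\<one>"] coset_eq_H_iff[OF cG] c cG by auto
    ultimately show False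
      using cz by (auto simp: modified_transversal_def)
  qed
  then have "x \<otimes> c \<sim> x \<otimes> (h \<otimes> z)"
    using cG by (intro core_cong_mult_left) auto
  moreover have "x \<in> ?M'"
    using x_in_z_transversal x_not_z_pow[of 1] by (auto simp: modified_transversal_def)
  ultimately have "x \<otimes> (h \<otimes> z) \<in> ?M'"
    using M'(5)[OF stable] by auto
  then consider "x \<otimes> (h \<otimes> z) \<in> ?M" | "x \<otimes> (h \<otimes> z) \<sim> h \<otimes> z"
    by (auto simp: modified_transversal_def)
  then show False
  proof cases
    case 1
    then have "x \<otimes> (h \<otimes> z) \<otimes> z [^] (- 1 :: int) \<in> ?M"
      by (rule z_transversal_mult)
    moreover have "z [^] (- 1 :: int) = inv z"
      by (simp add: int_pow_neg)
    ultimately show False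
      using xh_notin_z_transversal by (simp add: m_assoc)
  next
    case 2
    then have "x \<otimes> (h \<otimes> z) \<sim> \<one> \<otimes> (h \<otimes> z)"
      by simp
    then have "x \<sim> \<one>"
      by (rule core_cong_cancel_right) auto
    then show False
      using core_cong_coset x_not_z_pow[of 0] by fastforce
  qed
qed

lemma not_card_Itp_1:
  assumes fin: "finite (carrier G)"
  shows "card (Itp G H) \<noteq> 1"
proof
  assume card: "card (Itp G H) = 1"
  obtain S where S: "S \<in> NRTs G H" "S \<subseteq> z_transversal"
    by (rule ex_NRT_subset[OF core_transversal_z_transversal])
  obtain S' where S': "S' \<in> NRTs G H" "S' \<subseteq> modified_transversal"
    by (rule ex_NRT_subset[OF core_transversal_modified])
  have stab: "translations_stabilized S (nrt_op G H S)"
    using z z_transversal_mult[of _ 1]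
    by (intro translations_stabilizedI[OF core_transversal_z_transversal S, of z]) auto
  have "translations_stabilized S' (nrt_op G H S')"
    by (rule isotopic_translations_stabilized[OF isotopic_if_card_Itp_1[OF is_group card S(1) S'(1)]
          stab]) (rule nrt_op_closed[OF is_group S(1)])
  then show False
    by (rule translations_stabilizedD[OF core_transversal_modified S'])
      (rule modified_transversal_not_stable[OF fin])
qed

end

text \<open>The last term of the lower central series not contained in the core has an element
  outside the core, and its commutators with \<open>G\<close> all fall into the core.\<close>

lemma (in group_subgroup) ex_core_central:
  assumes nil: "\<exists>n. lower_central G n = {\<one>}" and H: "H \<noteq> carrier G"
  shows "\<exists>z. core_central z \<and> z \<notin> H"
proof -
  define N where "N = {g \<in> carrier G. g \<sim> \<one>}"
  have "{\<one>} \<subseteq> N"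
    by (simp add: N_def)
  then have "\<exists>n. lower_central G n \<subseteq> N"
    using nil by metis
  then obtain n where n: "lower_central G n \<subseteq> N" "\<And>k. k < n \<Longrightarrow> \<not> lower_central G k \<subseteq> N"
    using exists_least_iff[of "\<lambda>n. lower_central G n \<subseteq> N"] by blast
  have N_H: "N \<subseteq> H"
    using core_cong_coset[OF _ _ one_closed] coset_eq_H_iff unfolding N_def by blast
  \<comment> \<open>Term zero is all of \<open>G\<close>, which does not fit inside the core because
    \<open>H\<close> is proper.\<close>
  have "n \<noteq> 0"
    using n(1) N_H H H_subset by (intro notI) auto
  then obtain k where k: "n = Suc k"
    using not0_implies_Suc by blast
  have sub: "lower_central G m \<subseteq> carrier G" for m
  proof (induction m)
    case (Suc m)
    then show ?case
      unfolding lower_central.simps commutator_subgroup_def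
      by (intro generate_incl) auto
  qed simp
  obtain z where z: "z \<in> lower_central G k" "z \<notin> N"
    using n(2)[of k] k by blast
  have zG: "z \<in> carrier G"
    using z sub by blast
  have "z \<otimes> g \<sim> g \<otimes> z" if g: "g \<in> carrier G" for g
  proof -
    have "z \<otimes> g \<otimes> inv z \<otimes> inv g \<in> lower_central G n"
      using z g unfolding k lower_central.simps commutator_subgroup_def
      by (intro generate.incl) auto
    then have "z \<otimes> g \<otimes> inv z \<otimes> inv g \<sim> \<one>"
      using n(1) by (auto simp: N_def)
    then have "z \<otimes> g \<otimes> inv z \<otimes> inv g \<otimes> (g \<otimes> z) \<sim> \<one> \<otimes> (g \<otimes> z)"
      using zG g by (intro core_cong_mult_right) auto
    moreover have "z \<otimes> g \<otimes> inv z \<otimes> inv g \<otimes> (g \<otimes> z) = z \<otimes> g"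
      using zG g by (simp add: m_assoc inv_solve_left flip: m_assoc[of "inv g" g z])
    ultimately show ?thesis
      using zG g by simp
  qed
  then have central: "core_central z"
    using zG by (simp add: core_central_def)
  \<comment> \<open>If \<open>z\<close> were in \<open>H\<close> it would fix the coset
    \<open>H\<close>; being central modulo the core, it would then lie in the core.\<close>
  moreover have "z \<notin> H"
  proof
    assume "z \<in> H"
    then have "z \<sim> \<one>"
      using core_central_fix_coset[OF central one_closed] coset_eq_H_iff[OF zG] zG by simp
    then show False
      using z zG by (simp add: N_def)
  qed
  ultimately show ?thesis
    by blast
qed

theorem proposition2p8:
  fixes G :: "('a, 'b) monoid_scheme" and H :: "'a set"
  assumes "nilpotent_group G"
    and "finite (carrier G)"
    and "subgroup H G"
    and "card (Itp G H) = 1"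
  shows "normal H G"
proof (rule ccontr)
  assume not_normal: "\<not> normal H G"
  interpret nilpotent_group G by fact
  interpret group_subgroup G H
    by (intro group_subgroup.intro group_subgroup_axioms.intro is_group assms(3))
  obtain x h where x: "x \<in> carrier G" and h: "h \<in> H" and xh: "x \<otimes>\<^bsub>G\<^esub> h \<otimes>\<^bsub>G\<^esub> inv\<^bsub>G\<^esub> x \<notin> H"
    using not_normal assms(3) normal_inv_iff by blast
  have hG: "h \<in> carrier G"
    using h H_subset by blast
  have "H \<noteq> carrier G"
    using xh x hG by auto
  then obtain z where z: "core_central z" "z \<notin> H"
    using ex_core_central[OF nilpotent] by blast
  \<comment> \<open>Multiplying on the right by the inverse of \<open>x\<close> turns equality of
    these cosets into membership of the conjugate of \<open>h\<close> in \<open>H\<close>.\<close>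
  have "H #>\<^bsub>G\<^esub> (x \<otimes>\<^bsub>G\<^esub> h) \<noteq> H #>\<^bsub>G\<^esub> x"
    using coset_mult_right[of "x \<otimes>\<^bsub>G\<^esub> h" x "inv\<^bsub>G\<^esub> x"] coset_eq_H_iff[of "x \<otimes>\<^bsub>G\<^esub> h \<otimes>\<^bsub>G\<^esub> inv\<^bsub>G\<^esub> x"] xh x hG
    by auto
  then interpret non_normal_central G H z x h
    using z x h by (intro non_normal_central.intro non_normal_central_axioms.intro) unfold_locales
  show False
    using not_card_Itp_1 assms by blast
qed

end
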